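(* Let $d, n$ be positive integers. Let $\mathscr{N}_n(d)$ be the set of all $\lambda = (\lambda_1,\ldots,\lambda_d)$ where the $\lambda_i$ are nonnegative integers such that $\sum_{i=1}^d \lambda_i = n$. Then the polynomials $$p_\lambda(x) := (\lambda_1 x_1 + \cdots + \lambda_d x_d)^n, \qquad \lambda \in \mathscr{N}_n(d),$$ are linearly independent and form a basis for the space $\mathcal{P}_n(d)$ of homogeneous polynomials of degree $n$ in $x_1,\ldots,x_d$.
   Context: Polynomials have real coefficients, in the $d$ variables $x=(x_1,\ldots,x_d)$. $\mathcal{P}_n(d)$ is the real vector space of homogeneous polynomials of degree $n$ (including the zero polynomial), i.e. the linear span of the monomials $x_1^{\lambda_1}\cdots x_d^{\lambda_d}$, $\lambda \in \mathscr{N}_n(d)$. Linear independence is that of the family $(p_\lambda)_{\lambda \in \mathscr{N}_n(d)}$ over $\mathbb{R}$. *)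

theory Defs
  imports "HOL-Analysis.Finite_Function_Topology"
begin

text \<open>
  A real polynomial maps the exponents \<^typ>\<open>nat \<Rightarrow>\<^sub>0 nat\<close> of monomials to coefficients.
  The indeterminates are indexed by all natural numbers; those in play are
  \<open>x\<^sub>1, \<dots>, x\<^sub>d\<close>, and the carriers below restrict exponents to indices in \<open>{1..d}\<close>.
\<close>

type_synonym real_mpoly = "(nat \<Rightarrow>\<^sub>0 nat) \<Rightarrow>\<^sub>0 real"

definition indet :: "nat \<Rightarrow> real_mpoly" where
  "indet i = Poly_Mapping.single (Poly_Mapping.single i 1) 1"

text \<open>A tuple \<open>(\<lambda>\<^sub>1, \<dots>, \<lambda>\<^sub>d)\<close> is encoded as a function that vanishes outside \<open>{1..d}\<close>.\<close>

definition exponents :: "nat \<Rightarrow> nat \<Rightarrow> (nat \<Rightarrow>\<^sub>0 nat) set" where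
  "exponents n d =
    {l. Poly_Mapping.keys l \<subseteq> {1..d} \<and> (\<Sum>i=1..d. Poly_Mapping.lookup l i) = n}"

definition monomial :: "nat \<Rightarrow> (nat \<Rightarrow>\<^sub>0 nat) \<Rightarrow> real_mpoly" where
  "monomial d l = (\<Prod>i=1..d. indet i ^ Poly_Mapping.lookup l i)"

definition homogeneous_polys :: "nat \<Rightarrow> nat \<Rightarrow> real_mpoly set" where
  "homogeneous_polys n d = span (monomial d ` exponents n d)"

definition linear_form_power :: "nat \<Rightarrow> nat \<Rightarrow> (nat \<Rightarrow>\<^sub>0 nat) \<Rightarrow> real_mpoly" where
  "linear_form_power n d l = (\<Sum>i=1..d. real (Poly_Mapping.lookup l i) *\<^sub>R indet i) ^ n"

lemma lookup_scaleR:
  fixes p :: "'a \<Rightarrow>\<^sub>0 'b::real_vector"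
  shows "Poly_Mapping.lookup (c *\<^sub>R p) k = c *\<^sub>R Poly_Mapping.lookup p k"
proof -
  have "finite {i. c *\<^sub>R Poly_Mapping.lookup p i \<noteq> 0}"
    by (rule finite_subset[OF _ finite_keys[of p]]) (auto simp: in_keys_iff)
  then show ?thesis
    by (simp add: scaleR_poly_mapping_def Abs_poly_mapping_inverse)
qed

lemma indet_power: "indet i ^ m = Poly_Mapping.single (Poly_Mapping.single i m) 1"
  by (induction m) (simp_all add: indet_def mult_single flip: single_add)

lemma monomial_eq_single:
  assumes "l \<in> exponents n d"
  shows "monomial d l = Poly_Mapping.single l 1"
proof -
  have prod_single: "(\<Prod>i\<in>A. Poly_Mapping.single (f i) (1::real)) =
      Poly_Mapping.single (\<Sum>i\<in>A. f i) 1"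
    if "finite A" for A :: "nat set" and f :: "nat \<Rightarrow> nat \<Rightarrow>\<^sub>0 nat"
    using that by induction (simp_all add: mult_single)
  have sum_l: "(\<Sum>i=1..d. Poly_Mapping.single i (Poly_Mapping.lookup l i)) = l"
  proof (rule poly_mapping_eqI)
    fix k
    have "Poly_Mapping.lookup l k = 0" if "k \<notin> {1..d}"
      using assms that by (auto simp: exponents_def in_keys_iff)
    then show "Poly_Mapping.lookup (\<Sum>i=1..d. Poly_Mapping.single i (Poly_Mapping.lookup l i)) k =
        Poly_Mapping.lookup l k"
      by (auto simp: lookup_sum lookup_single when_def)
  qed
  show ?thesis
    unfolding monomial_def indet_power by (subst prod_single) (simp_all only: sum_l finite_atLeastAtMost)
qed

lemma homogeneous_polys_iff: "p \<in> homogeneous_polys n d \<longleftrightarrow> Poly_Mapping.keys p \<subseteq> exponents n d"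
proof
  assume "p \<in> homogeneous_polys n d"
  then show "Poly_Mapping.keys p \<subseteq> exponents n d"
    unfolding homogeneous_polys_def
  proof (induction rule: span_induct_alt)
    case base
    then show ?case by simp
  next
    case (step c q r)
    then obtain l where l: "l \<in> exponents n d" "q = Poly_Mapping.single l 1"
      using monomial_eq_single by auto
    have "Poly_Mapping.keys (c *\<^sub>R q) \<subseteq> {l}"
      by (auto simp: l in_keys_iff lookup_scaleR lookup_single when_def split: if_splits)
    with step l show ?case
      using Poly_Mapping.keys_add[of "c *\<^sub>R q" r] by auto
  qed
next
  assume keys: "Poly_Mapping.keys p \<subseteq> exponents n d"
  have "p = (\<Sum>l\<in>Poly_Mapping.keys p. Poly_Mapping.lookup p l *\<^sub>R Poly_Mapping.single l 1)"
    by (rule poly_mapping_eqI)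
      (auto simp: lookup_sum lookup_scaleR lookup_single when_def in_keys_iff
        if_distrib cong: if_cong)
  also have "\<dots> = (\<Sum>l\<in>Poly_Mapping.keys p. Poly_Mapping.lookup p l *\<^sub>R monomial d l)"
    using keys by (intro sum.cong) (auto simp: monomial_eq_single)
  also have "\<dots> \<in> homogeneous_polys n d"
    unfolding homogeneous_polys_def
    using keys by (intro span_sum span_scale span_base) auto
  finally show "p \<in> homogeneous_polys n d" .
qed

end

theory Submission
  imports Defs
begin

text \<open>
  Suppose \<open>\<Sum> c\<^sub>\<lambda> p\<^sub>\<lambda> = 0\<close>. Evaluating at \<open>x\<close> and differentiating \<open>n\<close> times in directions
  \<open>v\<^sub>1, \<dots>, v\<^sub>n\<close> gives \<open>\<Sum> c\<^sub>\<lambda> q(\<lambda>) = 0\<close> for every product \<open>q = \<langle>\<cdot>, v\<^sub>1\<rangle> \<cdots> \<langle>\<cdot>, v\<^sub>n\<rangle>\<close> of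
  \<open>n\<close> linear forms. For fixed \<open>\<mu>\<close> take the \<open>n\<close> linear forms
  \<open>x\<^sub>i - j (x\<^sub>1 + \<dots> + x\<^sub>d) / n\<close> with \<open>j < \<mu>\<^sub>i\<close>. At a point \<open>\<lambda>\<close> of the lattice simplex they
  take the values \<open>\<lambda>\<^sub>i - j\<close>, so their product vanishes there unless \<open>\<lambda> = \<mu>\<close>; hence
  \<open>c\<^sub>\<mu> = 0\<close>. The spanning property follows by counting.
\<close>

section \<open>Evaluation of polynomials at real points\<close>

definition eval_poly :: "nat \<Rightarrow> (nat \<Rightarrow> real) \<Rightarrow> real_mpoly \<Rightarrow> real" where
  "eval_poly d x p =
    (\<Sum>m\<in>Poly_Mapping.keys p. Poly_Mapping.lookup p m * (\<Prod>i=1..d. x i ^ Poly_Mapping.lookup m i))"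

lemma eval_poly_superset:
  assumes "finite A" "Poly_Mapping.keys p \<subseteq> A"
  shows "eval_poly d x p =
    (\<Sum>m\<in>A. Poly_Mapping.lookup p m * (\<Prod>i=1..d. x i ^ Poly_Mapping.lookup m i))"
  unfolding eval_poly_def
  by (rule sum.mono_neutral_left[OF assms]) (auto simp: in_keys_iff)

lemma eval_poly_zero [simp]: "eval_poly d x 0 = 0"
  by (simp add: eval_poly_def)

lemma eval_poly_add [simp]: "eval_poly d x (p + q) = eval_poly d x p + eval_poly d x q"
proof -
  let ?A = "Poly_Mapping.keys p \<union> Poly_Mapping.keys q"
  have "eval_poly d x (p + q) = (\<Sum>m\<in>?A. Poly_Mapping.lookup (p + q) m *
      (\<Prod>i=1..d. x i ^ Poly_Mapping.lookup m i))"
    by (rule eval_poly_superset) (simp_all add: Poly_Mapping.keys_add)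
  also have "\<dots> = eval_poly d x p + eval_poly d x q"
    by (simp add: eval_poly_superset[of ?A] lookup_add distrib_right sum.distrib)
  finally show ?thesis .
qed

lemma eval_poly_scaleR [simp]: "eval_poly d x (c *\<^sub>R p) = c * eval_poly d x p"
proof -
  have "eval_poly d x (c *\<^sub>R p) = (\<Sum>m\<in>Poly_Mapping.keys p. Poly_Mapping.lookup (c *\<^sub>R p) m *
      (\<Prod>i=1..d. x i ^ Poly_Mapping.lookup m i))"
    by (rule eval_poly_superset) (auto simp: in_keys_iff lookup_scaleR)
  then show ?thesis
    by (simp add: eval_poly_def lookup_scaleR sum_distrib_left mult.assoc)
qed

lemma eval_poly_sum: "eval_poly d x (\<Sum>a\<in>A. f a) = (\<Sum>a\<in>A. eval_poly d x (f a))"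
  by (induction A rule: infinite_finite_induct) simp_all

lemma eval_poly_single:
  "eval_poly d x (Poly_Mapping.single m c) = c * (\<Prod>i=1..d. x i ^ Poly_Mapping.lookup m i)"
  by (subst eval_poly_superset[of "{m}"]) auto

lemma poly_mapping_sum_single:
  "p = (\<Sum>m\<in>Poly_Mapping.keys p. Poly_Mapping.single m (Poly_Mapping.lookup p m))"
  by (rule poly_mapping_eqI)
    (auto simp: lookup_sum lookup_single when_def in_keys_iff)

text \<open>The product over \<open>{1..d}\<close> in effect sets every other indeterminate to 1, so
  multiplicativity needs no restriction on the exponents. Both sides are bilinear, which reduces the
  claim to single terms.\<close>

lemma eval_poly_mult [simp]: "eval_poly d x (p * q) = eval_poly d x p * eval_poly d x q"
proof -
  have single: "eval_poly d x (Poly_Mapping.single m a * Poly_Mapping.single k b) =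
      eval_poly d x (Poly_Mapping.single m a) * eval_poly d x (Poly_Mapping.single k b)" for m k a b
    by (simp add: mult_single eval_poly_single lookup_add power_add prod.distrib)
  show ?thesis
    by (subst (1 2) poly_mapping_sum_single[of p], subst (1 2) poly_mapping_sum_single[of q])
      (simp only: sum_product eval_poly_sum single)
qed

lemma eval_poly_one [simp]: "eval_poly d x 1 = 1"
  using eval_poly_single[of d x 0 1] by simp

lemma eval_poly_power [simp]: "eval_poly d x (p ^ n) = eval_poly d x p ^ n"
  by (induction n) simp_all

lemma eval_poly_indet:
  assumes "i \<in> {1..d}"
  shows "eval_poly d x (indet i) = x i"
proof -
  have "eval_poly d x (indet i) = (\<Prod>k=1..d. if k = i then x i else 1)"
    unfolding indet_def eval_poly_single mult_1
    by (rule prod.cong) (auto simp: lookup_single when_def)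
  with assms show ?thesis
    by simp
qed

lemma eval_linear_form_power:
  "eval_poly d x (linear_form_power n d l) = (\<Sum>i=1..d. real (Poly_Mapping.lookup l i) * x i) ^ n"
  unfolding linear_form_power_def
  by (simp add: eval_poly_sum eval_poly_indet)

section \<open>From powers of linear forms to products of linear forms\<close>

lemma sum_linear_powers_polarization:
  fixes a :: "'l \<Rightarrow> 'i \<Rightarrow> real" and c :: "'l \<Rightarrow> real"
  assumes "finite S"
    and "\<And>x. (\<Sum>l\<in>E. c l * (\<Sum>i\<in>I. a l i * x i) ^ card S) = 0"
  shows "(\<Sum>l\<in>E. c l * (\<Prod>s\<in>S. \<Sum>i\<in>I. a l i * v s i)) = 0"
  using assms
\<comment> \<open>One derivative in direction \<open>v s\<close> lowers the power by one and leaves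
  the factor \<open>\<Sum>i\<in>I. a l i * v s i\<close>, which is absorbed into the coefficient;
  hence \<open>c\<close> must vary in the induction.\<close>
proof (induction S arbitrary: c rule: finite_induct)
  case empty
  then show ?case by simp
next
  case (insert s S)
  let ?A = "\<lambda>l x. \<Sum>i\<in>I. a l i * x i"
  have "(\<Sum>l\<in>E. (c l * ?A l (v s)) * ?A l x ^ card S) = 0" for x
  proof -
    let ?k = "card S"
    \<comment> \<open>This is the assumed identity along the line \<open>x + t * v s\<close>. It
      vanishes for all \<open>t\<close>, so its derivative at 0, computed term by term, is
      0.\<close>
    let ?g = "\<lambda>t. \<Sum>l\<in>E. c l * (?A l x + t * ?A l (v s)) ^ Suc ?k"
    have "?g t = 0" for t
    proof -
      have "?A l x + t * ?A l (v s) = ?A l (\<lambda>i. x i + t * v s i)" for l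
        by (simp add: sum_distrib_left sum.distrib algebra_simps)
      with insert show ?thesis
        by simp
    qed
    then have "(?g has_real_derivative 0) (at 0)"
      by simp
    moreover have "(?g has_real_derivative
        (\<Sum>l\<in>E. c l * (real (Suc ?k) * ?A l x ^ ?k * ?A l (v s)))) (at 0)"
      by (auto intro!: derivative_eq_intros sum.cong simp del: power_Suc of_nat_Suc)
    ultimately have "(\<Sum>l\<in>E. c l * (real (Suc ?k) * ?A l x ^ ?k * ?A l (v s))) = 0"
      using DERIV_unique by blast
    also have "(\<Sum>l\<in>E. c l * (real (Suc ?k) * ?A l x ^ ?k * ?A l (v s))) =
        real (Suc ?k) * (\<Sum>l\<in>E. (c l * ?A l (v s)) * ?A l x ^ ?k)"
      unfolding sum_distrib_left[of "real (Suc ?k)"]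
      by (rule sum.cong) (simp_all add: mult_ac del: of_nat_Suc power_Suc)
    finally show ?thesis
      by simp
  qed
  from insert.IH[OF this] insert.hyps show ?case
    by (simp add: mult.assoc)
qed

section \<open>Lattice points of the simplex and linear independence\<close>

lemma exponents_eqI:
  assumes l: "l \<in> exponents n d" and m: "m \<in> exponents n d"
    and le: "\<And>i. i \<in> {1..d} \<Longrightarrow> Poly_Mapping.lookup m i \<le> Poly_Mapping.lookup l i"
  shows "l = m"
proof (rule poly_mapping_eqI)
  fix i
  show "Poly_Mapping.lookup l i = Poly_Mapping.lookup m i"
  proof (cases "i \<in> {1..d}")
    case True
    \<comment> \<open>Equal totals leave no room for a strict inequality in any coordinate.\<close>
    have "(\<Sum>i=1..d. Poly_Mapping.lookup m i) = (\<Sum>i=1..d. Poly_Mapping.lookup l i)"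
      using l m by (simp add: exponents_def)
    from sum_mono_inv[OF this le True] show ?thesis
      by simp
  next
    case False
    with l m have "i \<notin> Poly_Mapping.keys l" "i \<notin> Poly_Mapping.keys m"
      by (auto simp: exponents_def)
    then show ?thesis
      by (simp add: in_keys_iff)
  qed
qed

lemma finite_exponents: "finite (exponents n d)"
proof (rule finite_imageD)
  have "Poly_Mapping.lookup ` exponents n d \<subseteq>
      {f. \<forall>i. (i \<in> {1..d} \<longrightarrow> f i \<in> {0..n}) \<and> (i \<notin> {1..d} \<longrightarrow> f i = 0)}"
  proof clarify
    fix l i
    assume l: "l \<in> exponents n d"
    have "Poly_Mapping.lookup l i \<le> n" if "i \<in> {1..d}"
      using member_le_sum[OF that, of "Poly_Mapping.lookup l"] l by (simp add: exponents_def)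
    moreover have "Poly_Mapping.lookup l i = 0" if "i \<notin> {1..d}"
      using l that by (auto simp: exponents_def in_keys_iff)
    ultimately show "(i \<in> {1..d} \<longrightarrow> Poly_Mapping.lookup l i \<in> {0..n}) \<and>
        (i \<notin> {1..d} \<longrightarrow> Poly_Mapping.lookup l i = 0)"
      by auto
  qed
  then show "finite (Poly_Mapping.lookup ` exponents n d)"
    by (rule finite_subset) (intro finite_set_of_finite_funs; simp)
  show "inj_on Poly_Mapping.lookup (exponents n d)"
    by (auto intro: inj_onI poly_mapping_eqI)
qed

lemma linear_form_power_coeffs_zero:
  assumes "n > 0"
    and zero: "(\<Sum>l\<in>exponents n d. c l *\<^sub>R linear_form_power n d l) = 0"
    and m: "m \<in> exponents n d"
  shows "c m = 0"
proof -
  let ?E = "exponents n d"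
  \<comment> \<open>One index \<open>(i, j)\<close> per linear form. There are \<open>n\<close> of
    them because the entries of \<open>m\<close> sum to \<open>n\<close>, so the number of factors
    matches the power.\<close>
  define S where "S = (SIGMA i:{1..d}. {..<Poly_Mapping.lookup m i})"
  \<comment> \<open>Coefficients of a homogeneous form that agrees with \<open>x\<^sub>i - j\<close>
    wherever the coordinates sum to \<open>n\<close>.\<close>
  define v :: "nat \<times> nat \<Rightarrow> nat \<Rightarrow> real"
    where "v = (\<lambda>(i, j) k. (if k = i then 1 else 0) - real j / real n)"
  have fin: "finite S"
    by (simp add: S_def)
  have card: "card S = n"
    using m by (simp add: S_def exponents_def)
  have form: "(\<Sum>k=1..d. real (Poly_Mapping.lookup l k) * v (i, j) k) =
      real (Poly_Mapping.lookup l i) - real j" if l: "l \<in> ?E" and i: "i \<in> {1..d}" for l i j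
  proof -
    have "(\<Sum>k=1..d. real (Poly_Mapping.lookup l k) * v (i, j) k) =
        (\<Sum>k=1..d. if k = i then real (Poly_Mapping.lookup l k) else 0) -
        (\<Sum>k=1..d. real (Poly_Mapping.lookup l k)) * (real j / real n)"
      unfolding sum_distrib_right sum_subtractf[symmetric]
      by (intro sum.cong) (auto simp: v_def algebra_simps)
    also have "(\<Sum>k=1..d. real (Poly_Mapping.lookup l k)) = real n"
      using l by (simp add: exponents_def flip: of_nat_sum)
    finally show ?thesis
      using i \<open>n > 0\<close> by simp
  qed
  have "(\<Sum>l\<in>?E. c l * (\<Sum>i=1..d. real (Poly_Mapping.lookup l i) * x i) ^ card S) = 0" for x
  proof -
    have "eval_poly d x (\<Sum>l\<in>?E. c l *\<^sub>R linear_form_power n d l) = 0"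
      by (simp add: zero)
    then show ?thesis
      by (simp add: eval_poly_sum eval_linear_form_power card)
  qed
  from sum_linear_powers_polarization[OF fin this, of v]
  have "0 = (\<Sum>l\<in>?E. c l * (\<Prod>s\<in>S. \<Sum>k=1..d. real (Poly_Mapping.lookup l k) * v s k))"
    by simp
  also have "\<dots> = (\<Sum>l\<in>?E. c l *
      (\<Prod>(i, j)\<in>S. real (Poly_Mapping.lookup l i) - real j))"
    by (intro sum.cong arg_cong2[where f = "(*)"] prod.cong) (auto simp: S_def form simp del: One_nat_def)
  also have "\<dots> = (\<Sum>l\<in>{m}. c l * (\<Prod>(i, j)\<in>S. real (Poly_Mapping.lookup l i) - real j))"
  proof (rule sum.mono_neutral_right)
    show "\<forall>l\<in>?E - {m}. c l * (\<Prod>(i, j)\<in>S. real (Poly_Mapping.lookup l i) - real j) = 0"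
    proof
      fix l
      assume "l \<in> ?E - {m}"
      then obtain i where "i \<in> {1..d}" "Poly_Mapping.lookup l i < Poly_Mapping.lookup m i"
        using exponents_eqI[of l n d m] m by (metis DiffD1 DiffD2 insertI1 not_le)
      \<comment> \<open>Since \<open>l\<close> falls below \<open>m\<close> at \<open>i\<close>, the
        value \<open>j = lookup l i\<close> is an admissible second index, and its factor is zero at
        \<open>l\<close>.\<close>
      then have "(i, Poly_Mapping.lookup l i) \<in> S"
        by (simp add: S_def)
      with fin show "c l * (\<Prod>(i, j)\<in>S. real (Poly_Mapping.lookup l i) - real j) = 0"
        by (auto intro!: bexI prod_zero)
    qed
  qed (use m finite_exponents in auto)
  finally have "c m * (\<Prod>(i, j)\<in>S. real (Poly_Mapping.lookup m i) - real j) = 0"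
    by simp
  \<comment> \<open>At \<open>m\<close> itself every factor is positive, as \<open>j\<close> stays
    below the \<open>i\<close>-th entry of \<open>m\<close>.\<close>
  moreover have "(\<Prod>(i, j)\<in>S. real (Poly_Mapping.lookup m i) - real j) \<noteq> 0"
    using fin by (auto simp: prod_zero_iff S_def)
  ultimately show ?thesis
    by simp
qed

section \<open>Homogeneity of powers of linear forms\<close>

lemma subspace_homogeneous_polys: "subspace (homogeneous_polys n d)"
  unfolding homogeneous_polys_def by (rule subspace_span)

lemma indet_homogeneous: "i \<in> {1..d} \<Longrightarrow> indet i \<in> homogeneous_polys 1 d"
  by (auto simp: homogeneous_polys_iff indet_def exponents_def lookup_single when_def)

text \<open>Every exponent occurring in a product is a sum of exponents of the factors, and total
  degrees add.\<close>

lemma mult_homogeneous: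
  assumes "p \<in> homogeneous_polys m d" "q \<in> homogeneous_polys n d"
  shows "p * q \<in> homogeneous_polys (m + n) d"
  unfolding homogeneous_polys_iff
proof
  fix k
  assume "k \<in> Poly_Mapping.keys (p * q)"
  then obtain a b where "k = a + b" "a \<in> exponents m d" "b \<in> exponents n d"
    using keys_mult[of p q] assms unfolding homogeneous_polys_iff by fast
  then show "k \<in> exponents (m + n) d"
    using Poly_Mapping.keys_add[of a b] by (auto simp: exponents_def lookup_add sum.distrib)
qed

lemma power_homogeneous:
  assumes "p \<in> homogeneous_polys 1 d"
  shows "p ^ n \<in> homogeneous_polys n d"
proof (induction n)
  case 0
  show ?case
    by (simp add: homogeneous_polys_iff exponents_def)
next
  case (Suc n)
  then show ?case
    using mult_homogeneous[OF assms] by fastforce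
qed

lemma linear_form_power_homogeneous: "linear_form_power n d l \<in> homogeneous_polys n d"
  unfolding linear_form_power_def
  by (intro power_homogeneous subspace_sum subspace_scale subspace_homogeneous_polys
      indet_homogeneous)

theorem theorem3:
  fixes d n :: nat
  assumes "d > 0" and "n > 0"
  shows "inj_on (linear_form_power n d) (exponents n d)
    \<and> independent (linear_form_power n d ` exponents n d)
    \<and> span (linear_form_power n d ` exponents n d) = homogeneous_polys n d"
proof -
  let ?E = "exponents n d"
  let ?p = "linear_form_power n d"
  have fin: "finite ?E"
    by (rule finite_exponents)
  \<comment> \<open>Independence of the image as a set cannot detect coinciding members. Two equal
    ones would give a vanishing combination with coefficients 1 and -1.\<close>
  have inj: "inj_on ?p ?E"
  proof (rule inj_onI, rule ccontr)
    fix l m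
    assume lm: "l \<in> ?E" "m \<in> ?E" "?p l = ?p m" "l \<noteq> m"
    define c :: "_ \<Rightarrow> real" where "c k = (if k = l then 1 else if k = m then -1 else 0)" for k
    have "(\<Sum>k\<in>?E. c k *\<^sub>R ?p k) = (\<Sum>k\<in>{l, m}. c k *\<^sub>R ?p k)"
      using lm fin by (intro sum.mono_neutral_right) (auto simp: c_def)
    also have "\<dots> = 0"
      using lm by (simp add: c_def)
    finally have "c l = 0"
      using linear_form_power_coeffs_zero \<open>n > 0\<close> lm(1) by blast
    then show False
      by (simp add: c_def)
  qed
  have indep: "independent (?p ` ?E)"
  proof (rule independent_if_scalars_zero)
    fix f q
    assume "(\<Sum>q\<in>?p ` ?E. f q *\<^sub>R q) = 0" and q: "q \<in> ?p ` ?E"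
    then have "(\<Sum>l\<in>?E. f (?p l) *\<^sub>R ?p l) = 0"
      by (simp add: sum.reindex[OF inj])
    then show "f q = 0"
      using linear_form_power_coeffs_zero[where c = "\<lambda>l. f (?p l)"] \<open>n > 0\<close> q by auto
  qed (simp add: fin)
  have sub: "?p ` ?E \<subseteq> span (monomial d ` ?E)"
    using linear_form_power_homogeneous by (auto simp flip: homogeneous_polys_def)
  \<comment> \<open>Dimension count: the space is spanned by at most \<open>card ?E\<close>
    monomials, while by injectivity a \<open>q\<close> outside the span would yield
    \<open>card ?E + 1\<close> independent elements.\<close>
  have "q \<in> span (?p ` ?E)" if q: "q \<in> span (monomial d ` ?E)" for q
  proof (rule ccontr)
    assume q': "q \<notin> span (?p ` ?E)"
    with indep have "independent (insert q (?p ` ?E))"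
      by (rule independent_insertI[rotated])
    then have "card (insert q (?p ` ?E)) \<le> card (monomial d ` ?E)"
      using independent_span_bound[OF finite_imageI[OF fin]] sub q by blast
    also have "\<dots> \<le> card ?E"
      by (rule card_image_le[OF fin])
    finally show False
      using q' span_base[of q "?p ` ?E"] fin by (auto simp: card_image[OF inj] card_insert_if split: if_splits)
  qed
  with sub have "span (?p ` ?E) = homogeneous_polys n d"
    unfolding homogeneous_polys_def by (meson span_minimal subspace_span subset_antisym subsetI)
  with inj indep show ?thesis
    by simp
qed

end
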